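(* Every sequent $\Gamma\vdash S:\phi$ derivable in the proof calculus (relative to a Rec procedure table $T$) is valid.
   Context: Rec statements: $S ::= \mathbf{skip} \mid x := a \mid S_1;S_2 \mid \mathbf{if}\ b\ \mathbf{then}\ S_1\ \mathbf{else}\ S_2 \mid m() \mid Y$, where $a$, $b$ are side-effect-free arithmetic/Boolean expressions over global integer variables, $m$ ranges over procedures declared in a fixed procedure table $T$ of declarations $m\,\{S_m\}$ (unique names, bodies without statement variables), and $Y$ ranges over a set $\mathsf{SVar}$ of statement variables; each procedure $m$ has an associated unique statement variable $Y_m$. $\mathbf{State}$ = maps from variables to $\mathbb{Z}$; $\mathbf{State}^+$ = nonempty finite state sequences. Trace semantics: $A|_b=\{s\cdot\sigma\in A:\mathcal{B}[\![b]\!](s)=\mathbf{tt}\}$, $\sharp A=\{s\cdot s\cdot\sigma:s\cdot\sigma\in A\}$, $A\frown B=\{\sigma_A\cdot s\cdot\sigma_B:\sigma_A\cdot s\in A,s\cdot\sigma_B\in B\}$. For an interpretation $\mathcal{I}:\mathsf{SVar}\to 2^{\mathbf{State}^+}$ and $\rho$ mapping procedure names to trace sets: $\mathcal{S}_{tr}[\![\mathbf{skip}]\!]=\{s\cdot s\}$, $\mathcal{S}_{tr}[\![x:=a]\!]=\{s\cdot s[x\mapsto\mathcal{A}[\![a]\!](s)]\}$, sequencing is $\frown$, $\mathcal{S}_{tr}[\![\mathbf{if}\ b\ \mathbf{then}\ S_1\ \mathbf{else}\ S_2]\!]=(\sharp\mathcal{S}_{tr}[\![S_1]\!])|_b\cup(\sharp\mathcal{S}_{tr}[\![S_2]\!])|_{\neg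 b}$, $\mathcal{S}_{tr}[\![m()]\!]_\rho=\rho(m)$, $\mathcal{S}_{tr}[\![Y]\!]=\mathcal{I}(Y)$; $\rho_0$ is the least fixed point of $\rho\mapsto(\sharp\mathcal{S}_{tr}[\![S_{m}]\!]_\rho)_{m}$ and $\mathcal{S}^{\mathcal{I}}_{tr}[\![S]\!]$ is the semantics with $\rho_0$ and $\mathcal{I}$. Trace formulas: $\phi ::= p \mid R \mid X \mid \phi_1\wedge\phi_2 \mid \phi_1\vee\phi_2 \mid \phi_1\frown\phi_2 \mid \mu X.\phi$; $[\![p]\!]=\{s\cdot\sigma:s\models p\}$ (state formulas include Boolean expressions), $[\![R]\!]=\{s\cdot s':R(s,s')\}$, $[\![X]\!]_{\mathcal{V}}=\mathcal{V}(X)$, $\wedge,\vee,\frown$ as $\cap,\cup$, chop, $[\![\mu X.\phi]\!]_{\mathcal{V}}=\bigcap\{\gamma:[\![\phi]\!]_{\mathcal{V}[X\mapsto\gamma]}\subseteq\gamma\}$; $[\![\phi]\!]$ for closed $\phi$; $\phi'\models\phi$ iff $[\![\phi']\!]\subseteq[\![\phi]\!]$. $\mathit{Id}(s,s')$ iff $s'=s$; $\mathit{Sb}^a_x(s,s')$ iff $s'=s[x\mapsto\mathcal{A}[\![a]\!](s)]$. Judgments are $S:\phi$ with $\phi$ closed; sequents are $\Gamma\vdash S:\phi$ with $\Gamma$ a finite set of judgments. $S:\phi$ is valid in $\mathcal{I}$ if $\mathcal{S}^{\mathcal{I}}_{tr}[\![S]\!]\subseteq[\![\phi]\!]$; the sequent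 is valid if for every $\mathcal{I}$ in which all judgments of $\Gamma$ are valid, $S:\phi$ is valid in $\mathcal{I}$. Rules (premises above conclusion): (Skip) $\Gamma\vdash\mathbf{skip}:\mathit{Id}$; (Assign) $\Gamma\vdash x:=a:\mathit{Sb}^a_x$; (Seq) from $\Gamma\vdash S_1:\phi_1$ and $\Gamma\vdash S_2:\phi_2$ infer $\Gamma\vdash S_1;S_2:\phi_1\frown\phi_2$; (If) from $\Gamma\vdash\mathbf{skip};S_1:\neg b\vee\phi$ and $\Gamma\vdash\mathbf{skip};S_2:b\vee\phi$ infer $\Gamma\vdash\mathbf{if}\ b\ \mathbf{then}\ S_1\ \mathbf{else}\ S_2:\phi$; (Unfold) from $\Gamma\vdash S:\phi[\mu X.\phi/X]$ infer $\Gamma\vdash S:\mu X.\phi$; (Cons) from $\Gamma\vdash S:\phi'$ infer $\Gamma\vdash S:\phi$ provided $\phi'\models\phi$; (Call) if $Y_m:\phi_m\notin\Gamma$ and $m\,\{S_m\}\in T$, from $\Gamma, Y_m:\phi_m\vdash S_m[\mathbf{skip};Y_m/m(),\mathbf{skip};Y_{m_1}/m_1(),\dots,\mathbf{skip};Y_{m_k}/m_k()]:\phi_m$, where $Y_{m_1}:\phi_{m_1},\dots,Y_{m_k}:\phi_{m_k}$ are the judgments of $\Gamma$ for other procedures (and the substitution replaces every call of those procedures), infer $\Gamma\vdash m():\mathit{Id}\frown\phi_m$. In addition the calculus contains the standard Gentzen-style logical rules, in particular the axiom $\Gamma\vdash S:\phi$ whenever $S:\phi\in\Gamma$.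
   Formalization: False for arbitrary Γ (m {m'()}, m' {skip}, Γ = {Y_m' : false}); proved for Γ that, whenever valid in I, stays valid when each declared Y_m is reset to its body's semantics (e.g. Γ empty). Logical rules: axiom, weakening, cut, right conjunction; left disjunction, unsound here, is excluded. *)

theory Defs
  imports Main
begin

section \<open>Syntax of Rec\<close>

type_synonym 'v state = "'v \<Rightarrow> int"

text \<open>
  Expressions are represented by their (total, side-effect-free) evaluation functions, so every
  concrete expression syntax is covered.
\<close>
type_synonym 'v aexp = "'v state \<Rightarrow> int"
type_synonym 'v bexp = "'v state \<Rightarrow> bool"

datatype ('v, 'm, 'y) stmt =
    Skip
  | Assign 'v "'v aexp"
  | Seq "('v, 'm, 'y) stmt" "('v, 'm, 'y) stmt"
  | Cond "'v bexp" "('v, 'm, 'y) stmt" "('v, 'm, 'y) stmt"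
  | Call 'm
  | SVar 'y

type_synonym ('v, 'm, 'y) proc_table = "'m \<Rightarrow> ('v, 'm, 'y) stmt option"

primrec calls :: "('v, 'm, 'y) stmt \<Rightarrow> 'm set" where
  "calls Skip = {}"
| "calls (Assign x a) = {}"
| "calls (Seq S1 S2) = calls S1 \<union> calls S2"
| "calls (Cond b S1 S2) = calls S1 \<union> calls S2"
| "calls (Call m) = {m}"
| "calls (SVar y) = {}"

primrec svars :: "('v, 'm, 'y) stmt \<Rightarrow> 'y set" where
  "svars Skip = {}"
| "svars (Assign x a) = {}"
| "svars (Seq S1 S2) = svars S1 \<union> svars S2"
| "svars (Cond b S1 S2) = svars S1 \<union> svars S2"
| "svars (Call m) = {}"
| "svars (SVar y) = {y}"

definition wf_table :: "('v, 'm, 'y) proc_table \<Rightarrow> bool" where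
  "wf_table T \<longleftrightarrow>
     finite (dom T) \<and> (\<forall>S \<in> ran T. svars S = {} \<and> calls S \<subseteq> dom T)"

text \<open>\<open>abstract_calls M Y S\<close> replaces each call of some \<open>m \<in> M\<close> in \<open>S\<close> by \<open>skip; Y m\<close>.\<close>
primrec abstract_calls ::
  "'m set \<Rightarrow> ('m \<Rightarrow> 'y) \<Rightarrow> ('v, 'm, 'y) stmt \<Rightarrow> ('v, 'm, 'y) stmt" where
  "abstract_calls M Y Skip = Skip"
| "abstract_calls M Y (Assign x a) = Assign x a"
| "abstract_calls M Y (Seq S1 S2) = Seq (abstract_calls M Y S1) (abstract_calls M Y S2)"
| "abstract_calls M Y (Cond b S1 S2) = Cond b (abstract_calls M Y S1) (abstract_calls M Y S2)"
| "abstract_calls M Y (Call m) = (if m \<in> M then Seq Skip (SVar (Y m)) else Call m)"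
| "abstract_calls M Y (SVar y) = SVar y"


section \<open>Trace semantics\<close>

text \<open>The set \<open>State\<^sup>+\<close>.\<close>
definition traces :: "'v state list set" where
  "traces = {\<sigma>. \<sigma> \<noteq> []}"

definition restrict :: "'v state list set \<Rightarrow> 'v bexp \<Rightarrow> 'v state list set" where
  "restrict A b = {s # \<sigma> | s \<sigma>. s # \<sigma> \<in> A \<and> b s}"

definition sharp :: "'v state list set \<Rightarrow> 'v state list set" where
  "sharp A = {s # s # \<sigma> | s \<sigma>. s # \<sigma> \<in> A}"

definition chop :: "'v state list set \<Rightarrow> 'v state list set \<Rightarrow> 'v state list set" where
  "chop A B = {\<sigma>A @ [s] @ \<sigma>B | \<sigma>A s \<sigma>B. \<sigma>A @ [s] \<in> A \<and> s # \<sigma>B \<in> B}"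

type_synonym ('v, 'y) interp = "'y \<Rightarrow> 'v state list set"

definition interpretation_fun :: "('v, 'y) interp \<Rightarrow> bool" where
  "interpretation_fun I \<longleftrightarrow> (\<forall>y. I y \<subseteq> traces)"

primrec sem ::
  "('v, 'y) interp \<Rightarrow> ('m \<Rightarrow> 'v state list set) \<Rightarrow> ('v, 'm, 'y) stmt \<Rightarrow> 'v state list set" where
  "sem I \<rho> Skip = {[s, s] | s. True}"
| "sem I \<rho> (Assign x a) = {[s, s(x := a s)] | s. True}"
| "sem I \<rho> (Seq S1 S2) = chop (sem I \<rho> S1) (sem I \<rho> S2)"
| "sem I \<rho> (Cond b S1 S2) =
     restrict (sharp (sem I \<rho> S1)) b \<union> restrict (sharp (sem I \<rho> S2)) (\<lambda>s. \<not> b s)"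
| "sem I \<rho> (Call m) = \<rho> m"
| "sem I \<rho> (SVar y) = I y"

text \<open>
  Undeclared names get the empty trace set; this is irrelevant, since below only
  statements that call declared procedures are considered. The dependence on \<open>I\<close> is vacuous for
  well-formed tables, whose bodies contain no statement variables.
\<close>
definition rho0 ::
  "('v, 'm, 'y) proc_table \<Rightarrow> ('v, 'y) interp \<Rightarrow> 'm \<Rightarrow> 'v state list set" where
  "rho0 T I = lfp (\<lambda>\<rho> m. case T m of None \<Rightarrow> {} | Some S \<Rightarrow> sharp (sem I \<rho> S))"

definition prog_sem ::
  "('v, 'm, 'y) proc_table \<Rightarrow> ('v, 'y) interp \<Rightarrow> ('v, 'm, 'y) stmt \<Rightarrow> 'v state list set" where
  "prog_sem T I S = sem I (rho0 T I) S"


section \<open>Trace formulas\<close>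

text \<open>State formulas and binary relation symbols are represented by the predicates they denote.\<close>
datatype ('v, 'x) fml =
    Pred "'v state \<Rightarrow> bool"
  | Rel "'v state \<Rightarrow> 'v state \<Rightarrow> bool"
  | FVar 'x
  | And "('v, 'x) fml" "('v, 'x) fml"
  | Or "('v, 'x) fml" "('v, 'x) fml"
  | Chop "('v, 'x) fml" "('v, 'x) fml"
  | Mu 'x "('v, 'x) fml"

primrec fv :: "('v, 'x) fml \<Rightarrow> 'x set" where
  "fv (Pred p) = {}"
| "fv (Rel R) = {}"
| "fv (FVar X) = {X}"
| "fv (And \<phi> \<psi>) = fv \<phi> \<union> fv \<psi>"
| "fv (Or \<phi> \<psi>) = fv \<phi> \<union> fv \<psi>"
| "fv (Chop \<phi> \<psi>) = fv \<phi> \<union> fv \<psi>"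
| "fv (Mu X \<phi>) = fv \<phi> - {X}"

abbreviation closed :: "('v, 'x) fml \<Rightarrow> bool" where
  "closed \<phi> \<equiv> fv \<phi> = {}"

text \<open>
  \<open>fsubst \<phi> X \<psi>\<close> is \<open>\<phi>[\<psi>/X]\<close>. Bound variables are not renamed: it is only used with closed \<open>\<psi>\<close>,
  where no capture can occur.
\<close>
primrec fsubst :: "('v, 'x) fml \<Rightarrow> 'x \<Rightarrow> ('v, 'x) fml \<Rightarrow> ('v, 'x) fml" where
  "fsubst (Pred p) X \<psi> = Pred p"
| "fsubst (Rel R) X \<psi> = Rel R"
| "fsubst (FVar Z) X \<psi> = (if Z = X then \<psi> else FVar Z)"
| "fsubst (And \<phi>1 \<phi>2) X \<psi> = And (fsubst \<phi>1 X \<psi>) (fsubst \<phi>2 X \<psi>)"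
| "fsubst (Or \<phi>1 \<phi>2) X \<psi> = Or (fsubst \<phi>1 X \<psi>) (fsubst \<phi>2 X \<psi>)"
| "fsubst (Chop \<phi>1 \<phi>2) X \<psi> = Chop (fsubst \<phi>1 X \<psi>) (fsubst \<phi>2 X \<psi>)"
| "fsubst (Mu Z \<phi>) X \<psi> = (if Z = X then Mu Z \<phi> else Mu Z (fsubst \<phi> X \<psi>))"

primrec fsem_val :: "('v, 'x) fml \<Rightarrow> ('x \<Rightarrow> 'v state list set) \<Rightarrow> 'v state list set" where
  "fsem_val (Pred p) V = {s # \<sigma> | s \<sigma>. p s}"
| "fsem_val (Rel R) V = {[s, s'] | s s'. R s s'}"
| "fsem_val (FVar X) V = V X"
| "fsem_val (And \<phi> \<psi>) V = fsem_val \<phi> V \<inter> fsem_val \<psi> V"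
| "fsem_val (Or \<phi> \<psi>) V = fsem_val \<phi> V \<union> fsem_val \<psi> V"
| "fsem_val (Chop \<phi> \<psi>) V = chop (fsem_val \<phi> V) (fsem_val \<psi> V)"
| "fsem_val (Mu X \<phi>) V = \<Inter>{\<gamma>. \<gamma> \<subseteq> traces \<and> fsem_val \<phi> (V(X := \<gamma>)) \<subseteq> \<gamma>}"

text \<open>The meaning of a closed formula; the choice of the valuation is immaterial.\<close>
definition fsem :: "('v, 'x) fml \<Rightarrow> 'v state list set" where
  "fsem \<phi> = fsem_val \<phi> (\<lambda>_. {})"

definition entails :: "('v, 'x) fml \<Rightarrow> ('v, 'x) fml \<Rightarrow> bool" where
  "entails \<phi>' \<phi> \<longleftrightarrow> fsem \<phi>' \<subseteq> fsem \<phi>"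

definition Id_rel :: "'v state \<Rightarrow> 'v state \<Rightarrow> bool" where
  "Id_rel s s' \<longleftrightarrow> s' = s"

definition Sb_rel :: "'v \<Rightarrow> 'v aexp \<Rightarrow> 'v state \<Rightarrow> 'v state \<Rightarrow> bool" where
  "Sb_rel x a s s' \<longleftrightarrow> s' = s(x := a s)"


section \<open>Judgments, sequents and validity\<close>

type_synonym ('v, 'm, 'y, 'x) tr_judgment = "('v, 'm, 'y) stmt \<times> ('v, 'x) fml"

definition wf_judgment ::
  "('v, 'm, 'y) proc_table \<Rightarrow> ('v, 'm, 'y, 'x) tr_judgment \<Rightarrow> bool" where
  "wf_judgment T J \<longleftrightarrow> calls (fst J) \<subseteq> dom T \<and> closed (snd J)"

definition wf_sequent ::
  "('v, 'm, 'y) proc_table \<Rightarrow> ('v, 'm, 'y, 'x) tr_judgment set \<Rightarrow>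
   ('v, 'm, 'y) stmt \<Rightarrow> ('v, 'x) fml \<Rightarrow> bool" where
  "wf_sequent T \<Gamma> S \<phi> \<longleftrightarrow>
     finite \<Gamma> \<and> (\<forall>J \<in> \<Gamma>. wf_judgment T J) \<and> wf_judgment T (S, \<phi>)"

definition valid_in ::
  "('v, 'm, 'y) proc_table \<Rightarrow> ('v, 'y) interp \<Rightarrow> ('v, 'm, 'y, 'x) tr_judgment \<Rightarrow> bool" where
  "valid_in T I J \<longleftrightarrow> prog_sem T I (fst J) \<subseteq> fsem (snd J)"

definition valid_sequent ::
  "('v, 'm, 'y) proc_table \<Rightarrow> ('v, 'm, 'y, 'x) tr_judgment set \<Rightarrow>
   ('v, 'm, 'y) stmt \<Rightarrow> ('v, 'x) fml \<Rightarrow> bool" where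
  "valid_sequent T \<Gamma> S \<phi> \<longleftrightarrow>
     (\<forall>I. interpretation_fun I \<longrightarrow> (\<forall>J \<in> \<Gamma>. valid_in T I J) \<longrightarrow> valid_in T I (S, \<phi>))"


section \<open>The proof calculus\<close>

text \<open>
  \<open>Y m\<close> is the statement variable associated with the procedure \<open>m\<close>. In every rule the first
  premise says that the conclusion is a sequent; the remaining side conditions and premises are
  those of the calculus. The rules \<open>ax\<close>, \<open>weaken\<close>, \<open>cut\<close> and \<open>conj\<close> are the logical rules.
\<close>
inductive derivable ::
  "('v, 'm, 'y) proc_table \<Rightarrow> ('m \<Rightarrow> 'y) \<Rightarrow> ('v, 'm, 'y, 'x) tr_judgment set \<Rightarrow>
   ('v, 'm, 'y) stmt \<Rightarrow> ('v, 'x) fml \<Rightarrow> bool"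
  for T :: "('v, 'm, 'y) proc_table" and Y :: "'m \<Rightarrow> 'y" where
  skip:
    "wf_sequent T \<Gamma> Skip (Rel Id_rel) \<Longrightarrow>
     derivable T Y \<Gamma> Skip (Rel Id_rel)"
| assign:
    "wf_sequent T \<Gamma> (Assign x a) (Rel (Sb_rel x a)) \<Longrightarrow>
     derivable T Y \<Gamma> (Assign x a) (Rel (Sb_rel x a))"
| seq:
    "wf_sequent T \<Gamma> (Seq S1 S2) (Chop \<phi>1 \<phi>2) \<Longrightarrow>
     derivable T Y \<Gamma> S1 \<phi>1 \<Longrightarrow>
     derivable T Y \<Gamma> S2 \<phi>2 \<Longrightarrow>
     derivable T Y \<Gamma> (Seq S1 S2) (Chop \<phi>1 \<phi>2)"
| cond:
    "wf_sequent T \<Gamma> (Cond b S1 S2) \<phi> \<Longrightarrow>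
     derivable T Y \<Gamma> (Seq Skip S1) (Or (Pred (\<lambda>s. \<not> b s)) \<phi>) \<Longrightarrow>
     derivable T Y \<Gamma> (Seq Skip S2) (Or (Pred b) \<phi>) \<Longrightarrow>
     derivable T Y \<Gamma> (Cond b S1 S2) \<phi>"
| unfold:
    "wf_sequent T \<Gamma> S (Mu X \<phi>) \<Longrightarrow>
     derivable T Y \<Gamma> S (fsubst \<phi> X (Mu X \<phi>)) \<Longrightarrow>
     derivable T Y \<Gamma> S (Mu X \<phi>)"
| conseq:
    "wf_sequent T \<Gamma> S \<phi> \<Longrightarrow>
     entails \<phi>' \<phi> \<Longrightarrow>
     derivable T Y \<Gamma> S \<phi>' \<Longrightarrow>
     derivable T Y \<Gamma> S \<phi>"
| call:
    "wf_sequent T \<Gamma> (Call m) (Chop (Rel Id_rel) \<phi>m) \<Longrightarrow>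
     (SVar (Y m), \<phi>m) \<notin> \<Gamma> \<Longrightarrow>
     T m = Some Sm \<Longrightarrow>
     M = insert m {m' \<in> dom T. \<exists>\<phi>'. (SVar (Y m'), \<phi>') \<in> \<Gamma>} \<Longrightarrow>
     derivable T Y (insert (SVar (Y m), \<phi>m) \<Gamma>) (abstract_calls M Y Sm) \<phi>m \<Longrightarrow>
     derivable T Y \<Gamma> (Call m) (Chop (Rel Id_rel) \<phi>m)"
| ax:
    "wf_sequent T \<Gamma> S \<phi> \<Longrightarrow>
     (S, \<phi>) \<in> \<Gamma> \<Longrightarrow>
     derivable T Y \<Gamma> S \<phi>"
| weaken:
    "wf_sequent T \<Gamma>' S \<phi> \<Longrightarrow>
     \<Gamma> \<subseteq> \<Gamma>' \<Longrightarrow>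
     derivable T Y \<Gamma> S \<phi> \<Longrightarrow>
     derivable T Y \<Gamma>' S \<phi>"
| cut:
    "wf_sequent T \<Gamma> S \<phi> \<Longrightarrow>
     derivable T Y \<Gamma> S' \<psi> \<Longrightarrow>
     derivable T Y (insert (S', \<psi>) \<Gamma>) S \<phi> \<Longrightarrow>
     derivable T Y \<Gamma> S \<phi>"
| conj:
    "wf_sequent T \<Gamma> S (And \<phi> \<psi>) \<Longrightarrow>
     derivable T Y \<Gamma> S \<phi> \<Longrightarrow>
     derivable T Y \<Gamma> S \<psi> \<Longrightarrow>
     derivable T Y \<Gamma> S (And \<phi> \<psi>)"


section \<open>Antecedents respecting the procedure table\<close>

text \<open>\<open>I\<close>, with the variable of every declared procedure reset to the semantics of its body.\<close>
definition proc_interp ::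
  "('v, 'm, 'y) proc_table \<Rightarrow> ('m \<Rightarrow> 'y) \<Rightarrow> ('v, 'y) interp \<Rightarrow> ('v, 'y) interp" where
  "proc_interp T Y I =
     (\<lambda>y. if y \<in> Y ` dom T then prog_sem T I (the (T (inv_into (dom T) Y y))) else I y)"

text \<open>
  What \<open>\<Gamma>\<close> assumes about the variables \<open>Y m\<close> of declared procedures must hold of the actual
  bodies. This cannot be dropped from the soundness theorem: for \<open>m {m'()}\<close>, \<open>m' {skip}\<close>, the
  sequent \<open>Y m' : false \<turnstile> m() : Id \<frown> false\<close> is derivable by \<open>call\<close>, \<open>seq\<close>, \<open>skip\<close>, \<open>ax\<close> and
  \<open>conseq\<close>, but it is not valid: if \<open>I (Y m') = {}\<close>, the antecedent holds and the succedent
  does not. The condition is automatic if no such variable occurs in \<open>\<Gamma>\<close>, in particular if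
  \<open>\<Gamma>\<close> is empty.
\<close>
definition respects_table ::
  "('v, 'm, 'y) proc_table \<Rightarrow> ('m \<Rightarrow> 'y) \<Rightarrow> ('v, 'm, 'y, 'x) tr_judgment set \<Rightarrow> bool" where
  "respects_table T Y \<Gamma> \<longleftrightarrow>
     (\<forall>I. interpretation_fun I \<longrightarrow> (\<forall>J \<in> \<Gamma>. valid_in T I J) \<longrightarrow>
        (\<forall>J \<in> \<Gamma>. valid_in T (proc_interp T Y I) J))"

end

(*
  Soundness is proved for the finite approximations of the recursion. Let body_approx T n m be
  the n-th Kleene approximation of the body of m; then a call of m is approximated by
  sharp (body_approx T n m). At stage n, the invariant on the antecedent is that it holds both in
  the given interpretation I and in I with every Y m reset to body_approx T n m. This passes to
  smaller stages by monotonicity, and to cut formulas because resetting is idempotent. For (Call),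
  an induction on k <= n shows body_approx T k m <= [[phi_m]]: the body with calls abstracted,
  interpreted with each Y m reset to stage k, is body_approx T (k + 1) m. By continuity of the
  semantics, what holds at all finite stages holds for the least fixed point.
*)
theory Submission
  imports Defs
begin

section \<open>Trace operators and program semantics\<close>

lemma chop_mono: "A \<subseteq> A' \<Longrightarrow> B \<subseteq> B' \<Longrightarrow> chop A B \<subseteq> chop A' B'"
  unfolding chop_def by blast

lemma sharp_mono: "A \<subseteq> A' \<Longrightarrow> sharp A \<subseteq> sharp A'"
  unfolding sharp_def by blast

lemma restrict_mono: "A \<subseteq> A' \<Longrightarrow> restrict A b \<subseteq> restrict A' b"
  unfolding restrict_def by blast

lemma restrict_sharp_UN: "restrict (sharp (\<Union>n. A n)) b = (\<Union>n. restrict (sharp (A n)) b)"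
  unfolding restrict_def sharp_def by auto

text \<open>The statement \<open>skip\<close> and the formula \<open>Rel Id_rel\<close> both denote
  this stutter set, so one law serves both as left factor of a chop.\<close>

lemma chop_stutter: "chop {\<sigma>. \<exists>s. \<sigma> = [s, s]} A = sharp A"
  unfolding chop_def sharp_def by force

lemma sem_Seq_Skip: "sem I \<rho> (Seq Skip S) = sharp (sem I \<rho> S)"
  by (simp add: chop_stutter)

lemma sem_mono:
  assumes "\<And>y. I y \<subseteq> I' y" and "\<And>m. \<rho> m \<subseteq> \<rho>' m"
  shows "sem I \<rho> S \<subseteq> sem I' \<rho>' S"
proof (induction S)
  case (Seq S1 S2)
  then show ?case by (simp add: chop_mono)
next
  case (Cond b S1 S2)
  then show ?case
    by (simp add: restrict_mono sharp_mono le_supI1 le_supI2)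
qed (use assms in auto)

lemma sem_cong_svars:
  "(\<And>y. y \<in> svars S \<Longrightarrow> I y = I' y) \<Longrightarrow> sem I \<rho> S = sem I' \<rho> S"
  by (induction S) auto

text \<open>Sequencing is the only case that combines stages: its two factors may need different
  ones, and monotonicity of the chain moves both to the maximum.\<close>

lemma sem_continuous:
  fixes R :: "nat \<Rightarrow> 'm \<Rightarrow> 'v state list set"
  assumes mono: "\<And>i j m. i \<le> j \<Longrightarrow> R i m \<subseteq> R j m"
  shows "sem I (\<lambda>m. \<Union>n. R n m) S \<subseteq> (\<Union>n. sem I (R n) S)"
proof (induction S)
  case (Seq S1 S2)
  show ?case
  proof
    fix \<sigma> assume "\<sigma> \<in> sem I (\<lambda>m. \<Union>n. R n m) (Seq S1 S2)"
    then obtain \<sigma>A s \<sigma>B where \<sigma>: "\<sigma> = \<sigma>A @ [s] @ \<sigma>B"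
      and A: "\<sigma>A @ [s] \<in> sem I (\<lambda>m. \<Union>n. R n m) S1"
      and B: "s # \<sigma>B \<in> sem I (\<lambda>m. \<Union>n. R n m) S2"
      by (auto simp: chop_def)
    obtain i where i: "\<sigma>A @ [s] \<in> sem I (R i) S1" using A Seq.IH(1) by blast
    obtain j where j: "s # \<sigma>B \<in> sem I (R j) S2" using B Seq.IH(2) by blast
    have "sem I (R i) S1 \<subseteq> sem I (R (max i j)) S1" "sem I (R j) S2 \<subseteq> sem I (R (max i j)) S2"
      by (intro sem_mono mono order_refl max.cobounded1 max.cobounded2)+
    then have "\<sigma>A @ [s] \<in> sem I (R (max i j)) S1" "s # \<sigma>B \<in> sem I (R (max i j)) S2"
      using i j by blast+
    then have "\<sigma> \<in> sem I (R (max i j)) (Seq S1 S2)"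
      unfolding \<sigma> by (auto simp: chop_def)
    then show "\<sigma> \<in> (\<Union>n. sem I (R n) (Seq S1 S2))" by blast
  qed
next
  case (Cond b S1 S2)
  let ?A = "\<lambda>S. sem I (\<lambda>m. \<Union>n. R n m) S"
  have "restrict (sharp (?A S1)) b \<subseteq> (\<Union>n. restrict (sharp (sem I (R n) S1)) b)"
    "restrict (sharp (?A S2)) (\<lambda>s. \<not> b s) \<subseteq> (\<Union>n. restrict (sharp (sem I (R n) S2)) (\<lambda>s. \<not> b s))"
    using Cond.IH[THEN sharp_mono, THEN restrict_mono] unfolding restrict_sharp_UN .
  then show ?case by (simp add: subset_iff) blast
qed auto


section \<open>Formula semantics\<close>

text \<open>Formulas contain no negation. Under \<open>Mu\<close>, a larger valuation leaves fewer
  prefixed points to intersect, so the intersection grows.\<close>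

lemma fsem_val_mono: "(\<And>X. V X \<subseteq> V' X) \<Longrightarrow> fsem_val \<phi> V \<subseteq> fsem_val \<phi> V'"
proof (induction \<phi> arbitrary: V V')
  case (Chop \<phi>1 \<phi>2)
  then show ?case by (simp add: chop_mono)
next
  case (Mu X \<phi>)
  have "fsem_val \<phi> (V(X := \<gamma>)) \<subseteq> fsem_val \<phi> (V'(X := \<gamma>))" for \<gamma>
    by (rule Mu.IH) (use Mu.prems in auto)
  then show ?case by simp blast
next
  case (And \<phi>1 \<phi>2)
  then show ?case by simp blast
next
  case (Or \<phi>1 \<phi>2)
  then show ?case by simp blast
qed auto

lemma fsem_val_cong: "(\<And>X. X \<in> fv \<phi> \<Longrightarrow> V X = V' X) \<Longrightarrow> fsem_val \<phi> V = fsem_val \<phi> V'"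
proof (induction \<phi> arbitrary: V V')
  case (Mu X \<phi>)
  have "fsem_val \<phi> (V(X := \<gamma>)) = fsem_val \<phi> (V'(X := \<gamma>))" for \<gamma>
    by (rule Mu.IH) (use Mu.prems in auto)
  then show ?case by simp
next
  case (And \<phi>1 \<phi>2)
  have "fsem_val \<phi>1 V = fsem_val \<phi>1 V'" "fsem_val \<phi>2 V = fsem_val \<phi>2 V'"
    by (rule And.IH; use And.prems in simp)+
  then show ?case by simp
next
  case (Or \<phi>1 \<phi>2)
  have "fsem_val \<phi>1 V = fsem_val \<phi>1 V'" "fsem_val \<phi>2 V = fsem_val \<phi>2 V'"
    by (rule Or.IH; use Or.prems in simp)+
  then show ?case by simp
next
  case (Chop \<phi>1 \<phi>2)
  have "fsem_val \<phi>1 V = fsem_val \<phi>1 V'" "fsem_val \<phi>2 V = fsem_val \<phi>2 V'"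
    by (rule Chop.IH; use Chop.prems in simp)+
  then show ?case by simp
qed auto

text \<open>A closed \<open>\<psi>\<close> has the same meaning under all valuations, so that
  meaning can be carried unchanged under a binder.\<close>

lemma fsem_val_fsubst:
  assumes "closed \<psi>"
  shows "fsem_val (fsubst \<phi> X \<psi>) V = fsem_val \<phi> (V(X := fsem \<psi>))"
proof (induction \<phi> arbitrary: V)
  case (FVar Z)
  then show ?case using fsem_val_cong[of \<psi> V "\<lambda>_. {}"] assms by (simp add: fsem_def)
next
  case (Mu Z \<phi>)
  show ?case
  proof (cases "Z = X")
    case False
    then have "fsem_val (fsubst \<phi> X \<psi>) (V(Z := \<gamma>)) = fsem_val \<phi> (V(X := fsem \<psi>, Z := \<gamma>))" for \<gamma>
      by (simp only: Mu.IH fun_upd_twist[OF False])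
    with False show ?thesis by (simp only: fsubst.simps fsem_val.simps if_False)
  next
    case True
    then show ?thesis by (simp only: fsubst.simps fsem_val.simps if_True fun_upd_upd simp_thms)
  qed
qed auto

text \<open>The Knaster-Tarski half behind (Unfold): the fixed point lies below each prefixed
  \<open>\<gamma>\<close>, so by monotonicity its image does too, hence lies below their
  intersection.\<close>

lemma fsem_fsubst_Mu_subset:
  assumes "closed (Mu X \<phi>)"
  shows "fsem (fsubst \<phi> X (Mu X \<phi>)) \<subseteq> fsem (Mu X \<phi>)"
proof -
  have eq: "fsem (fsubst \<phi> X (Mu X \<phi>)) = fsem_val \<phi> ((\<lambda>_. {})(X := fsem (Mu X \<phi>)))"
    using fsem_val_fsubst[OF assms] by (simp add: fsem_def)
  have "fsem_val \<phi> ((\<lambda>_. {})(X := fsem (Mu X \<phi>))) \<subseteq> \<gamma>"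
    if \<gamma>: "\<gamma> \<subseteq> traces" "fsem_val \<phi> ((\<lambda>_. {})(X := \<gamma>)) \<subseteq> \<gamma>" for \<gamma>
  proof -
    have "fsem (Mu X \<phi>) \<subseteq> \<gamma>" using \<gamma> by (auto simp: fsem_def)
    then have "fsem_val \<phi> ((\<lambda>_. {})(X := fsem (Mu X \<phi>))) \<subseteq> fsem_val \<phi> ((\<lambda>_. {})(X := \<gamma>))"
      by (intro fsem_val_mono) auto
    then show ?thesis using \<gamma>(2) by blast
  qed
  then have "fsem_val \<phi> ((\<lambda>_. {})(X := fsem (Mu X \<phi>))) \<subseteq> fsem (Mu X \<phi>)"
    by (subst (2) fsem_def) auto
  then show ?thesis unfolding eq .
qed

lemma fsem_Chop_Id: "fsem (Chop (Rel Id_rel) \<phi>) = sharp (fsem \<phi>)"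
  by (simp add: fsem_def Id_rel_def chop_stutter)


section \<open>Finite approximations\<close>

text \<open>These approximate bare bodies, without the stutter of a call, since \<open>Y m\<close>
  stands for the body in \<open>skip; Y m\<close>. The empty interpretation makes them independent
  of \<open>I\<close>; bodies of a well-formed table contain no statement variables.\<close>

primrec body_approx ::
  "('v, 'm, 'y) proc_table \<Rightarrow> nat \<Rightarrow> 'm \<Rightarrow> 'v state list set" where
  "body_approx T 0 = (\<lambda>m. {})"
| "body_approx T (Suc n) = (\<lambda>m. case T m of None \<Rightarrow> {}
     | Some S \<Rightarrow> sem (\<lambda>_. {}) (\<lambda>m'. sharp (body_approx T n m')) S)"

abbreviation call_approx ::
  "('v, 'm, 'y) proc_table \<Rightarrow> nat \<Rightarrow> 'm \<Rightarrow> 'v state list set" where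
  "call_approx T n \<equiv> \<lambda>m. sharp (body_approx T n m)"

lemma body_approx_Suc_mono: "body_approx T n m \<subseteq> body_approx T (Suc n) m"
proof (induction n arbitrary: m)
  case (Suc n)
  have "sem (\<lambda>_. {}) (call_approx T n) S \<subseteq> sem (\<lambda>_. {}) (call_approx T (Suc n)) S" for S
    by (rule sem_mono) (use sharp_mono[OF Suc.IH] in auto)
  then show ?case by (auto split: option.splits)
qed simp

lemma body_approx_mono: "i \<le> j \<Longrightarrow> body_approx T i m \<subseteq> body_approx T j m"
  by (rule lift_Suc_mono_le[of "\<lambda>n. body_approx T n m"]) (rule body_approx_Suc_mono)

lemma wf_table_svars: "wf_table T \<Longrightarrow> T m = Some S \<Longrightarrow> svars S = {}"
  unfolding wf_table_def by (auto simp: ran_def)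

lemma sem_body_interp_irrelevant:
  "wf_table T \<Longrightarrow> T m = Some S \<Longrightarrow> sem I \<rho> S = sem I' \<rho> S"
  by (intro sem_cong_svars) (simp add: wf_table_svars)

section \<open>The least fixed point as the limit of the approximations\<close>

lemma rho0_unfold:
  fixes T :: "('v, 'm, 'y) proc_table"
  shows "rho0 T I m = (case T m of None \<Rightarrow> {} | Some S \<Rightarrow> sharp (sem I (rho0 T I) S))"
proof -
  have "mono (\<lambda>\<rho> m. case T m of None \<Rightarrow> {} | Some S \<Rightarrow> sharp (sem I \<rho> S))"
  proof (rule monoI, rule le_funI)
    fix \<rho> \<rho>' :: "'m \<Rightarrow> 'v state list set" and m
    assume le: "\<rho> \<le> \<rho>'"
    have "sharp (sem I \<rho> S) \<subseteq> sharp (sem I \<rho>' S)" for S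
      by (intro sharp_mono sem_mono) (use le in \<open>auto simp: le_fun_def\<close>)
    then show "(case T m of None \<Rightarrow> {} | Some S \<Rightarrow> sharp (sem I \<rho> S))
        \<le> (case T m of None \<Rightarrow> {} | Some S \<Rightarrow> sharp (sem I \<rho>' S))"
      by (auto split: option.splits)
  qed
  then show ?thesis
    unfolding rho0_def by (subst lfp_unfold) auto
qed

lemma call_approx_subset_rho0:
  assumes "wf_table T"
  shows "call_approx T n m \<subseteq> rho0 T I m"
proof (induction n arbitrary: m)
  case 0
  then show ?case by (simp add: sharp_def)
next
  case (Suc n)
  show ?case
  proof (cases "T m")
    case None
    then show ?thesis by (simp add: sharp_def)
  next
    case (Some S)
    have "sem (\<lambda>_. {}) (call_approx T n) S \<subseteq> sem I (rho0 T I) S"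
      by (rule sem_mono) (use Suc.IH in auto)
    then show ?thesis
      using Some by (subst rho0_unfold) (simp add: sharp_mono)
  qed
qed

text \<open>By continuity, the pointwise union of all stages is a prefixed point of the functional
  defining \<open>rho0\<close>, and so bounds it.\<close>

lemma rho0_subset_call_approx:
  assumes "wf_table T"
  shows "rho0 T I m \<subseteq> (\<Union>n. call_approx T n m)"
proof -
  have "rho0 T I \<le> (\<lambda>m. \<Union>n. call_approx T n m)"
    unfolding rho0_def
  proof (rule lfp_lowerbound, rule le_funI)
    fix m
    show "(case T m of None \<Rightarrow> {} | Some S \<Rightarrow> sharp (sem I (\<lambda>m. \<Union>n. call_approx T n m) S))
        \<le> (\<Union>n. call_approx T n m)"
    proof (cases "T m")
      case (Some S)
      have "sem I (\<lambda>m. \<Union>n. call_approx T n m) S \<subseteq> (\<Union>n. sem I (call_approx T n) S)"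
        by (rule sem_continuous) (intro sharp_mono body_approx_mono)
      \<comment> \<open>Evaluating the body at stage \<open>n\<close> gives stage
        \<open>Suc n\<close>, so the union is shifted by one.\<close>
      also have "\<dots> \<subseteq> (\<Union>n. body_approx T (Suc n) m)"
        using Some sem_body_interp_irrelevant[OF assms Some, of I _ "\<lambda>_. {}"] by simp
      finally have "sharp (sem I (\<lambda>m. \<Union>n. call_approx T n m) S)
          \<subseteq> sharp (\<Union>n. body_approx T (Suc n) m)"
        by (rule sharp_mono)
      also have "\<dots> \<subseteq> (\<Union>n. call_approx T n m)"
        unfolding sharp_def by blast
      finally show ?thesis using Some by simp
    qed simp
  qed
  then show ?thesis by (simp add: le_fun_def)
qed

lemma prog_sem_subset_approx:
  assumes "wf_table T"
  shows "prog_sem T I S \<subseteq> (\<Union>n. sem I (call_approx T n) S)"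
proof -
  have "prog_sem T I S \<subseteq> sem I (\<lambda>m. \<Union>n. call_approx T n m) S"
    unfolding prog_sem_def by (rule sem_mono) (use rho0_subset_call_approx[OF assms] in auto)
  also have "\<dots> \<subseteq> (\<Union>n. sem I (call_approx T n) S)"
    by (rule sem_continuous) (intro sharp_mono body_approx_mono)
  finally show ?thesis .
qed


section \<open>Soundness at finite stages\<close>

definition valid_at ::
  "('v, 'y) interp \<Rightarrow> ('m \<Rightarrow> 'v state list set) \<Rightarrow> ('v, 'm, 'y, 'x) tr_judgment \<Rightarrow> bool" where
  "valid_at I \<rho> J \<longleftrightarrow> sem I \<rho> (fst J) \<subseteq> fsem (snd J)"

text \<open>The finite-stage counterpart of \<open>proc_interp\<close>.\<close>

definition reset_interp ::
  "('v, 'm, 'y) proc_table \<Rightarrow> ('m \<Rightarrow> 'y) \<Rightarrow> nat \<Rightarrow> ('v, 'y) interp \<Rightarrow> ('v, 'y) interp" where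
  "reset_interp T Y n I =
     (\<lambda>y. if y \<in> Y ` dom T then body_approx T n (inv_into (dom T) Y y) else I y)"

text \<open>The first half serves the axiom rule; the second serves (Call), whose premise is
  evaluated in reset interpretations.\<close>

definition admissible ::
  "('v, 'm, 'y) proc_table \<Rightarrow> ('m \<Rightarrow> 'y) \<Rightarrow> nat \<Rightarrow> ('v, 'y) interp \<Rightarrow>
   ('v, 'm, 'y, 'x) tr_judgment set \<Rightarrow> bool" where
  "admissible T Y n I \<Gamma> \<longleftrightarrow>
     (\<forall>J \<in> \<Gamma>. valid_at I (call_approx T n) J \<and>
        valid_at (reset_interp T Y n I) (call_approx T n) J)"

lemma valid_at_antimono:
  assumes "valid_at I' \<rho>' J" "\<And>y. I y \<subseteq> I' y" "\<And>m. \<rho> m \<subseteq> \<rho>' m"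
  shows "valid_at I \<rho> J"
  using assms(1) sem_mono[of I I' \<rho> \<rho>' "fst J", OF assms(2,3)] unfolding valid_at_def by blast

lemma reset_interp_idem: "reset_interp T Y n (reset_interp T Y n I) = reset_interp T Y n I"
  by (rule ext) (simp add: reset_interp_def)

lemma reset_interp_proc:
  "inj_on Y (dom T) \<Longrightarrow> m \<in> dom T \<Longrightarrow> reset_interp T Y n I (Y m) = body_approx T n m"
  by (simp add: reset_interp_def)

lemma admissible_reset:
  "admissible T Y n I \<Gamma> \<Longrightarrow> admissible T Y n (reset_interp T Y n I) \<Gamma>"
  by (simp add: admissible_def reset_interp_idem)

text \<open>Judgments bound the semantics from above, so they survive when the interpretation and
  the meaning of calls both shrink.\<close>

lemma admissible_reset_le:
  assumes "admissible T Y n I \<Gamma>" "k \<le> n"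
  shows "admissible T Y k (reset_interp T Y k I) \<Gamma>"
proof -
  have "valid_at (reset_interp T Y k I) (call_approx T k) J" if "J \<in> \<Gamma>" for J
  proof (rule valid_at_antimono)
    show "valid_at (reset_interp T Y n I) (call_approx T n) J"
      using assms(1) that by (simp add: admissible_def)
    show "reset_interp T Y k I y \<subseteq> reset_interp T Y n I y" for y
      by (simp add: reset_interp_def body_approx_mono[OF assms(2)])
    show "call_approx T k m \<subseteq> call_approx T n m" for m
      by (intro sharp_mono body_approx_mono assms(2))
  qed
  then show ?thesis by (simp add: admissible_def reset_interp_idem)
qed

text \<open>The assumption makes a call of \<open>m\<close> and its replacement
  \<open>skip; Y m\<close> denote the same traces.\<close>

lemma sem_abstract_calls:
  assumes "\<And>m. m \<in> M \<Longrightarrow> \<rho> m = sharp (I (Y m))"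
  shows "sem I \<rho> (abstract_calls M Y S) = sem I \<rho> S"
  by (induction S) (simp_all add: assms chop_stutter)

text \<open>Both \<open>n\<close> and \<open>I\<close> must vary in the rule induction: (Call) uses
  its premise at smaller stages, and cut uses its first premise in the reset interpretation as
  well.\<close>

lemma derivable_valid_at:
  fixes T :: "('v, 'm, 'y) proc_table" and \<phi> :: "('v, 'x) fml"
  assumes wf: "wf_table T" and inj: "inj_on Y (dom T)"
    and "derivable T Y \<Gamma> S \<phi>" and "admissible T Y n I \<Gamma>"
  shows "valid_at I (call_approx T n) (S, \<phi>)"
  using assms(3,4)
proof (induction arbitrary: n I rule: derivable.induct)
  case (skip \<Gamma>)
  then show ?case by (auto simp: valid_at_def fsem_def Id_rel_def)
next
  case (assign \<Gamma> x a)
  then show ?case by (auto simp: valid_at_def fsem_def Sb_rel_def)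
next
  case (seq \<Gamma> S1 S2 \<phi>1 \<phi>2)
  then show ?case by (simp add: valid_at_def fsem_def chop_mono)
next
  case (cond \<Gamma> b S1 S2 \<phi>)
  \<comment> \<open>The left disjunct of each bound is contradicted by the restriction that the
    conditional puts on that branch.\<close>
  have "sharp (sem I (call_approx T n) S1) \<subseteq> {s # \<sigma> | s \<sigma>. \<not> b s} \<union> fsem \<phi>"
    "sharp (sem I (call_approx T n) S2) \<subseteq> {s # \<sigma> | s \<sigma>. b s} \<union> fsem \<phi>"
    using cond.IH[OF cond.prems] unfolding valid_at_def fst_conv snd_conv sem_Seq_Skip
    by (simp_all add: fsem_def)
  then show ?case unfolding valid_at_def fst_conv snd_conv sem.simps restrict_def by blast
next
  case (unfold \<Gamma> S X \<phi>)
  have "closed (Mu X \<phi>)" using unfold.hyps(1) by (simp add: wf_sequent_def wf_judgment_def)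
  then show ?case
    using unfold.IH[OF unfold.prems] fsem_fsubst_Mu_subset[of X \<phi>]
    unfolding valid_at_def by auto
next
  case (conseq \<Gamma> S \<phi> \<phi>')
  then show ?case unfolding valid_at_def entails_def by force
next
  case (call \<Gamma> m \<phi>m Sm M)
  have m: "m \<in> dom T" and M: "M \<subseteq> dom T" using call.hyps by auto
  \<comment> \<open>Stage 0 is empty; each later stage needs the claim one stage below as the
    assumption on \<open>Y m\<close>.\<close>
  have "body_approx T k m \<subseteq> fsem \<phi>m" if "k \<le> n" for k
    using that
  proof (induction k)
    case (Suc k)
    let ?I = "reset_interp T Y k I" and ?\<rho> = "call_approx T k"
    have "valid_at ?I ?\<rho> (SVar (Y m), \<phi>m)"
      using Suc by (simp add: valid_at_def reset_interp_proc[OF inj m])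
    then have "admissible T Y k ?I (insert (SVar (Y m), \<phi>m) \<Gamma>)"
      using admissible_reset_le[OF call.prems, of k] Suc.prems
      by (simp add: admissible_def reset_interp_idem)
    then have "sem ?I ?\<rho> (abstract_calls M Y Sm) \<subseteq> fsem \<phi>m"
      using call.IH unfolding valid_at_def by simp
    \<comment> \<open>All of \<open>M\<close> is declared, so every abstracted variable has its
      stage-\<open>k\<close> body as reset value.\<close>
    also have "sem ?I ?\<rho> (abstract_calls M Y Sm) = sem ?I ?\<rho> Sm"
      by (rule sem_abstract_calls) (simp add: reset_interp_proc[OF inj subsetD[OF M]])
    also have "\<dots> = body_approx T (Suc k) m"
      using call.hyps(3) sem_body_interp_irrelevant[OF wf call.hyps(3)] by simp
    finally show ?case .
  qed simp
  then show ?case by (simp add: valid_at_def fsem_Chop_Id sharp_mono)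
next
  case (ax \<Gamma> S \<phi>)
  then show ?case by (simp add: admissible_def)
next
  case (weaken \<Gamma>' S \<phi> \<Gamma>)
  then have "admissible T Y n I \<Gamma>" unfolding admissible_def by blast
  then show ?case by (rule weaken.IH)
next
  case (cut \<Gamma> S \<phi> S' \<psi>)
  \<comment> \<open>The first premise, applied at \<open>I\<close> and at its reset, yields the two
    halves required of the cut formula.\<close>
  have "admissible T Y n I (insert (S', \<psi>) \<Gamma>)"
    using cut.prems cut.IH(1)[OF cut.prems] cut.IH(1)[OF admissible_reset[OF cut.prems]]
    by (simp add: admissible_def)
  then show ?case by (rule cut.IH(2))
next
  case (conj \<Gamma> S \<phi> \<psi>)
  then show ?case by (simp add: valid_at_def fsem_def)
qed

section \<open>From finite stages to validity of sequents\<close>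

lemma body_approx_subset_prog_sem:
  assumes "wf_table T" "T m = Some S"
  shows "body_approx T n m \<subseteq> prog_sem T I S"
proof (cases n)
  case (Suc k)
  have "sem (\<lambda>_. {}) (call_approx T k) S \<subseteq> sem I (rho0 T I) S"
    by (rule sem_mono) (use call_approx_subset_rho0[OF assms(1)] in auto)
  then show ?thesis using Suc assms(2) by (simp add: prog_sem_def)
qed simp

text \<open>Antecedents valid in \<open>proc_interp\<close> thereby pass down to every reset
  interpretation.\<close>

lemma reset_interp_subset_proc_interp:
  assumes "wf_table T"
  shows "reset_interp T Y n I y \<subseteq> proc_interp T Y I y"
proof (cases "y \<in> Y ` dom T")
  case True
  then have "inv_into (dom T) Y y \<in> dom T" by (rule inv_into_into)
  then obtain S where "T (inv_into (dom T) Y y) = Some S" by blast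
  then show ?thesis
    using True body_approx_subset_prog_sem[OF assms]
    by (simp add: reset_interp_def proc_interp_def)
qed (simp add: reset_interp_def proc_interp_def)

theorem mainTheorem5:
  fixes T :: "('v, 'm, 'y) proc_table"
    and Y :: "'m \<Rightarrow> 'y"
    and \<Gamma> :: "('v, 'm, 'y, 'x) tr_judgment set"
    and S :: "('v, 'm, 'y) stmt"
    and \<phi> :: "('v, 'x) fml"
  assumes "wf_table T"
    and "inj_on Y (dom T)"
    and "derivable T Y \<Gamma> S \<phi>"
    and "respects_table T Y \<Gamma>"
  shows "valid_sequent T \<Gamma> S \<phi>"
  unfolding valid_sequent_def
proof (intro allI impI)
  fix I :: "('v, 'y) interp"
  assume I: "interpretation_fun I" "\<forall>J \<in> \<Gamma>. valid_in T I J"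
  then have P: "\<forall>J \<in> \<Gamma>. valid_in T (proc_interp T Y I) J"
    using assms(4) by (simp add: respects_table_def)
  have valid: "valid_at I' (rho0 T I') J" if "valid_in T I' J"
    for I' and J :: "('v, 'm, 'y, 'x) tr_judgment"
    using that by (simp add: valid_at_def valid_in_def prog_sem_def)
  \<comment> \<open>Validity in \<open>I\<close> gives the first half at every stage, and
    \<open>respects_table\<close> gives the second through \<open>proc_interp\<close>.\<close>
  have "admissible T Y n I \<Gamma>" for n
    unfolding admissible_def
  proof (intro ballI conjI)
    fix J assume J: "J \<in> \<Gamma>"
    show "valid_at I (call_approx T n) J"
      by (rule valid_at_antimono[OF valid])
        (use I J in blast, simp, rule call_approx_subset_rho0[OF assms(1)])
    show "valid_at (reset_interp T Y n I) (call_approx T n) J"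
      by (rule valid_at_antimono[OF valid])
        (use P J in blast, rule reset_interp_subset_proc_interp[OF assms(1)],
          rule call_approx_subset_rho0[OF assms(1)])
  qed
  then have "(\<Union>n. sem I (call_approx T n) S) \<subseteq> fsem \<phi>"
    using derivable_valid_at[OF assms(1-3)] by (simp add: valid_at_def UN_least)
  then show "valid_in T I (S, \<phi>)"
    using prog_sem_subset_approx[OF assms(1), of I S] by (simp add: valid_in_def)
qed

end
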